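(* Let $B$ be a finite bidirected graph, let $X$ and $Y$ be sets of vertices of $B$ such that there is no nontrivial path in $B$ with both endpoints in $X$, and let $\mathcal P,\mathcal Q$ be sets of pairwise vertex-disjoint $X$--$Y$ paths. Then there is a set $\mathcal R$ of pairwise vertex-disjoint $X$--$Y$ paths such that the set of first vertices of the paths in $\mathcal P$ is a subset of the set of first vertices of the paths in $\mathcal R$, and the set of last vertices of the paths in $\mathcal Q$ is a subset of the set of last vertices of the paths in $\mathcal R$.
   Context: A bidirected graph $B=(G,\sigma)$ is a loopless multigraph $G$ together with a map $\sigma$ assigning to each half-edge $(e,u)$ ($u$ an endpoint of the edge $e$) a sign $\sigma(e,u)\in\{+,-\}$. A path in $B$ is a sequence $v_0e_1v_1\dots e_\ell v_\ell$ of pairwise distinct vertices $v_i$ and edges $e_i$, where $e_i$ joins $v_{i-1}$ and $v_i$ and $\sigma(e_{i+1},v_i)=-\sigma(e_i,v_i)$ for $1\le i<\ell$; it is trivial if $\ell=0$. For sets $X,Y$ of vertices, a path $P$ is an $X$--$Y$ path if its first vertex is the unique vertex of $P$ in $X$ and its last vertex is the unique vertex of $P$ in $Y$ (trivial paths are allowed). *)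

theory Defs
  imports Main
begin

datatype sign = Plus | Minus

primrec opp :: "sign \<Rightarrow> sign" where
  "opp Plus = Minus"
| "opp Minus = Plus"

text \<open>The sign of the half-edge \<open>(e, u)\<close> is \<open>halfsign B e u\<close>; its values at pairs
  \<open>(e, u)\<close> in which \<open>u\<close> is not an endpoint of \<open>e\<close> are irrelevant.\<close>

record ('v, 'e) bidigraph =
  verts :: "'v set"
  edges :: "'e set"
  ends :: "'e \<Rightarrow> 'v set"
  halfsign :: "'e \<Rightarrow> 'v \<Rightarrow> sign"

text \<open>Edges are abstract, so parallel edges are allowed; looplessness is the requirement that
  every edge has exactly two endpoints.\<close>

definition bidirected_graph :: "('v, 'e) bidigraph \<Rightarrow> bool" where
  "bidirected_graph B \<longleftrightarrow> (\<forall>e \<in> edges B. ends B e \<subseteq> verts B \<and> card (ends B e) = 2)"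

definition finite_bidirected_graph :: "('v, 'e) bidigraph \<Rightarrow> bool" where
  "finite_bidirected_graph B \<longleftrightarrow> bidirected_graph B \<and> finite (verts B) \<and> finite (edges B)"

text \<open>The sequence \<open>v\<^sub>0 e\<^sub>1 v\<^sub>1 \<dots> e\<^sub>l v\<^sub>l\<close> is encoded as the pair of lists
  \<open>([v\<^sub>0, \<dots>, v\<^sub>l], [e\<^sub>1, \<dots>, e\<^sub>l])\<close>, so that the edge \<open>e\<^sub>i\<close> is
  \<open>path_edges P ! (i - 1)\<close>.\<close>

type_synonym ('v, 'e) walk = "'v list \<times> 'e list"

abbreviation path_verts :: "('v, 'e) walk \<Rightarrow> 'v list" where
  "path_verts \<equiv> fst"

abbreviation path_edges :: "('v, 'e) walk \<Rightarrow> 'e list" where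
  "path_edges \<equiv> snd"

definition is_path :: "('v, 'e) bidigraph \<Rightarrow> ('v, 'e) walk \<Rightarrow> bool" where
  "is_path B P \<longleftrightarrow>
     length (path_verts P) = Suc (length (path_edges P)) \<and>
     set (path_verts P) \<subseteq> verts B \<and> set (path_edges P) \<subseteq> edges B \<and>
     distinct (path_verts P) \<and> distinct (path_edges P) \<and>
     (\<forall>i < length (path_edges P).
        ends B (path_edges P ! i) = {path_verts P ! i, path_verts P ! Suc i}) \<and>
     (\<forall>i. 1 \<le> i \<and> i < length (path_edges P) \<longrightarrow>
        halfsign B (path_edges P ! i) (path_verts P ! i) =
          opp (halfsign B (path_edges P ! (i - 1)) (path_verts P ! i)))"

definition trivial_path :: "('v, 'e) walk \<Rightarrow> bool" where
  "trivial_path P \<longleftrightarrow> length (path_edges P) = 0"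

definition first_vertex :: "('v, 'e) walk \<Rightarrow> 'v" where
  "first_vertex P = hd (path_verts P)"

definition last_vertex :: "('v, 'e) walk \<Rightarrow> 'v" where
  "last_vertex P = last (path_verts P)"

definition XY_path ::
    "('v, 'e) bidigraph \<Rightarrow> 'v set \<Rightarrow> 'v set \<Rightarrow> ('v, 'e) walk \<Rightarrow> bool" where
  "XY_path B X Y P \<longleftrightarrow> is_path B P \<and>
     set (path_verts P) \<inter> X = {first_vertex P} \<and>
     set (path_verts P) \<inter> Y = {last_vertex P}"

definition disjoint_XY_paths ::
    "('v, 'e) bidigraph \<Rightarrow> 'v set \<Rightarrow> 'v set \<Rightarrow> ('v, 'e) walk set \<Rightarrow> bool" where
  "disjoint_XY_paths B X Y \<P> \<longleftrightarrow> (\<forall>P \<in> \<P>. XY_path B X Y P) \<and>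
     pairwise (\<lambda>P Q. set (path_verts P) \<inter> set (path_verts Q) = {}) \<P>"

end

theory Submission
  imports Defs
begin

text \<open>Split every vertex outside \<open>X \<union> Y\<close> into its two signs. A set of disjoint \<open>X\<close>--\<open>Y\<close> paths then
  becomes an involution moving along edges on the paths and swapping the two signs of a vertex
  elsewhere (a matching of the split graph), and paths are recovered as orbits of this involution and
  the sign swap. Let \<open>p\<close> and \<open>q\<close> come from \<open>\<P>\<close> and \<open>\<Q>\<close>. Replace \<open>q\<close> by \<open>p\<close> on all joint orbits that do
  not lose a last vertex of \<open>\<Q>\<close>. Since \<open>X\<close> is clean, no such involution covers more
  vertices of \<open>X\<close> than of \<open>Y\<close>; this counting replaces the parity argument of the bipartite
  Mendelsohn--Dulmage theorem, and shows that these orbits contain every first vertex of \<open>\<P>\<close>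
  not yet covered by \<open>q\<close> and that every covered vertex of \<open>Y\<close> ends a path from \<open>X\<close>.\<close>

lemma opp_neq [simp]: "opp s \<noteq> s" "s \<noteq> opp s"
  by (cases s; simp)+

lemma opp_opp [simp]: "opp (opp s) = s"
  by (cases s; simp)

lemma neq_sign_iff: "s \<noteq> t \<longleftrightarrow> s = opp t"
  by (cases s; cases t; simp)

lemma finite_UNIV_sign: "finite (UNIV :: sign set)"
proof -
  have "UNIV = {Plus, Minus}"
    using sign.exhaust by blast
  then show ?thesis
    by (metis finite.emptyI finite.insertI)
qed

section \<open>Alternating orbits of two involutions\<close>

text \<open>Walks through the union of the matchings given by \<open>f\<close> and \<open>g\<close>.
  The first step is by \<open>g\<close> because the start \<open>x\<close> will be a fixed point of
  \<open>f\<close>, that is, an end of its component.\<close>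

primrec alt :: "('a \<Rightarrow> 'a) \<Rightarrow> ('a \<Rightarrow> 'a) \<Rightarrow> 'a \<Rightarrow> nat \<Rightarrow> 'a" where
  "alt f g x 0 = x"
| "alt f g x (Suc i) = (if even i then g else f) (alt f g x i)"

definition invariant :: "('a \<Rightarrow> 'a) \<Rightarrow> 'a set \<Rightarrow> bool" where
  "invariant f C \<longleftrightarrow> (\<forall>w \<in> C. f w \<in> C)"

lemma invariant_compl:
  assumes "\<And>w. f (f w) = w" and "invariant f C"
  shows "invariant f (- C)"
  using assms unfolding invariant_def by (metis ComplD ComplI)

lemma invariant_Union:
  assumes "\<And>C. C \<in> \<C> \<Longrightarrow> invariant f C"
  shows "invariant f (\<Union> \<C>)"
  using assms unfolding invariant_def by blast

locale two_involutions =
  fixes f g :: "'a \<Rightarrow> 'a" and x :: 'a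
  assumes ff [simp]: "f (f w) = w" and gg [simp]: "g (g w) = w" and fx: "f x = x"
begin

abbreviation s :: "nat \<Rightarrow> 'a" where "s \<equiv> alt f g x"

lemma alt_back: "(if even i then g else f) (s (Suc i)) = s i"
  by simp

text \<open>The step leaving \<open>i\<close> and the step entering \<open>Suc (i + 2 * d)\<close>
  use the same involution, so a coincidence moves inwards from both sides until it becomes a
  stationary step.\<close>

lemma alt_neq_odd:
  assumes "\<forall>k<K. s (Suc k) \<noteq> s k"
  shows "Suc (i + 2 * d) \<le> K \<Longrightarrow> s i \<noteq> s (Suc (i + 2 * d))"
proof (induction d arbitrary: i)
  case 0
  then show ?case
    using assms[rule_format, of i] by auto
next
  case (Suc d)
  let ?h = "if even i then g else f"
  have 1: "s (Suc i) \<noteq> s (Suc (Suc i + 2 * d))"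
    by (rule Suc.IH) (use Suc.prems in simp)
  have 2: "?h (s (Suc (Suc (Suc i + 2 * d)))) = s (Suc (Suc i + 2 * d))"
    using alt_back[of "Suc (Suc i + 2 * d)"] by (simp del: alt.simps)
  have 3: "?h (s i) = s (Suc i)"
    by simp
  show ?case
  proof
    assume "s i = s (Suc (i + 2 * Suc d))"
    then have "?h (s i) = ?h (s (Suc (Suc (Suc i + 2 * d))))"
      by (simp del: alt.simps)
    then show False
      using 1 unfolding 2 3 by simp
  qed
qed

text \<open>Both indices are entered by the same involution, so a coincidence moves back to index 0.
  There \<open>s (2 * d) = x\<close> is fixed by \<open>f\<close>, which makes the step into
  \<open>2 * d\<close> stationary.\<close>

lemma alt_neq_even:
  assumes "\<forall>k<K. s (Suc k) \<noteq> s k" and "d > 0"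
  shows "i + 2 * d \<le> K \<Longrightarrow> s i \<noteq> s (i + 2 * d)"
proof (induction i)
  case 0
  obtain c where c: "d = Suc c"
    using assms(2) gr0_implies_Suc by blast
  have "f (s (Suc (Suc (2 * c)))) = s (Suc (2 * c))"
    using alt_back[of "Suc (2 * c)"] by simp
  moreover have "s (Suc (Suc (2 * c))) \<noteq> s (Suc (2 * c))"
    using assms(1)[rule_format, of "Suc (2 * c)"] 0 c by simp
  ultimately have "s (Suc (Suc (2 * c))) \<noteq> x"
    using fx by metis
  then show ?case
    unfolding c by simp
next
  case (Suc i)
  then have "s i \<noteq> s (i + 2 * d)"
    by simp
  moreover have "even (i + 2 * d) \<longleftrightarrow> even i"
    by simp
  ultimately show ?case
    using alt_back[of i] alt_back[of "i + 2 * d"] by (metis add_Suc)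
qed

lemma inj_on_alt:
  assumes "\<forall>k<K. s (Suc k) \<noteq> s k"
  shows "inj_on s {..K}"
proof (rule linorder_inj_onI')
  fix i j
  assume ij: "i \<in> {..K}" "j \<in> {..K}" "i < j"
  show "s i \<noteq> s j"
  proof (cases "even (j - i)")
    case True
    then obtain d where "j - i = 2 * d" by blast
    then have "j = i + 2 * d" "d > 0"
      using ij by auto
    then show ?thesis
      using alt_neq_even[OF assms] ij by auto
  next
    case False
    then obtain d where "j - i = 2 * d + 1" by (rule oddE)
    then have "j = Suc (i + 2 * d)"
      using ij by auto
    then show ?thesis
      using alt_neq_odd[OF assms] ij by auto
  qed
qed

text \<open>Pigeonhole: without a stationary step, \<open>s\<close> would inject
  \<open>card W + 1\<close> indices into \<open>W\<close>.\<close>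

lemma alt_stops:
  assumes "finite W" and "x \<in> W" and "invariant f W" and "invariant g W"
  obtains K where "s (Suc K) = s K" and "\<forall>k<K. s (Suc k) \<noteq> s k"
proof -
  have W: "s i \<in> W" for i
    by (induction i) (use assms in \<open>auto simp: invariant_def\<close>)
  have "\<exists>K. s (Suc K) = s K"
  proof (rule ccontr)
    assume "\<nexists>K. s (Suc K) = s K"
    then have "inj_on s {..card W}"
      by (intro inj_on_alt) auto
    moreover have "s ` {..card W} \<subseteq> W"
      using W by auto
    ultimately have "card {..card W} \<le> card W"
      using card_inj_on_le assms(1) by blast
    then show False by simp
  qed
  then show thesis
    using that[of "LEAST K. s (Suc K) = s K"] not_less_Least LeastI_ex[of "\<lambda>K. s (Suc K) = s K"]
    by blast
qed

context
  fixes K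
  assumes stop: "s (Suc K) = s K" and go: "\<forall>k<K. s (Suc k) \<noteq> s k"
begin

text \<open>One involution leads to the successor and the other to the predecessor; at the two ends
  the missing neighbour is the point itself, by \<open>stop\<close> and \<open>fx\<close>.\<close>

lemma alt_orbit_step:
  assumes "i \<le> K"
  shows "f (s i) \<in> s ` {..K}" and "g (s i) \<in> s ` {..K}"
proof -
  have up: "(if even i then g else f) (s i) \<in> s ` {..K}"
  proof (cases "i = K")
    case True
    then show ?thesis
      using stop by auto
  next
    case False
    then have "Suc i \<in> {..K}"
      using assms by simp
    then have "s (Suc i) \<in> s ` {..K}"
      by (rule imageI)
    then show ?thesis by simp
  qed
  have down: "(if even i then f else g) (s i) \<in> s ` {..K}"
  proof (cases i)
    case 0
    then show ?thesis using fx by force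
  next
    case (Suc j)
    then have "(if even i then f else g) (s i) = s j"
      using alt_back[of j] by auto
    then show ?thesis
      using Suc assms by auto
  qed
  show "f (s i) \<in> s ` {..K}" "g (s i) \<in> s ` {..K}"
    using up down by (cases "even i"; simp)+
qed

lemma invariant_orbit: "invariant f (s ` {..K})" "invariant g (s ` {..K})"
  unfolding invariant_def using alt_orbit_step by auto

text \<open>The component is a path: an inner point is entered by one involution and left by the
  other.\<close>

lemma alt_inner_not_fixed:
  assumes "0 < i" and "i < K"
  shows "f (s i) \<noteq> s i" and "g (s i) \<noteq> s i"
proof -
  obtain j where j: "i = Suc j"
    using assms(1) gr0_implies_Suc by blast
  have "(if even j then g else f) (s i) \<noteq> s i"
    using go[rule_format, of j] alt_back[of j] assms(2) j by auto
  moreover have "(if even i then g else f) (s i) \<noteq> s i"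
    using go[rule_format, of i] assms(2) by simp
  ultimately show "f (s i) \<noteq> s i" "g (s i) \<noteq> s i"
    using j by (cases "even i"; simp)+
qed

lemma alt_last_not_fixed:
  assumes "0 < K"
  shows "(if even K then f else g) (s K) \<noteq> s K"
proof -
  obtain j where j: "K = Suc j"
    using assms gr0_implies_Suc by blast
  then show ?thesis
    using go[rule_format, of j] alt_back[of j] by auto
qed

text \<open>Every step can be undone, so membership passes back to \<open>x\<close> and from there
  to the whole orbit.\<close>

lemma orbit_minimal:
  assumes "invariant f C" and "invariant g C" and "s i \<in> C"
  shows "s j \<in> C"
proof -
  have "x \<in> C"
    using assms(3)
  proof (induction i)
    case (Suc i)
    then have "(if even i then g else f) (s (Suc i)) \<in> C"
      using assms(1,2) by (simp del: alt.simps add: invariant_def)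
    then have "s i \<in> C"
      unfolding alt_back .
    then show ?case
      by (rule Suc.IH)
  qed simp
  then show ?thesis
    by (induction j) (use assms in \<open>auto simp: invariant_def\<close>)
qed

end

end

section \<open>Linkings as involutions on half-vertices\<close>

lemma XY_path_X_iff:
  assumes "XY_path B X Y P" and "v \<in> set (path_verts P)"
  shows "v \<in> X \<longleftrightarrow> v = first_vertex P" and "v \<in> Y \<longleftrightarrow> v = last_vertex P"
  using assms unfolding XY_path_def by auto

lemma is_path_first_last:
  assumes "is_path B P"
  shows "first_vertex P = path_verts P ! 0"
    and "last_vertex P = path_verts P ! length (path_edges P)"
    and "first_vertex P \<in> set (path_verts P)" and "last_vertex P \<in> set (path_verts P)"
proof -
  have "path_verts P \<noteq> []" and len: "length (path_verts P) = Suc (length (path_edges P))"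
    using assms unfolding is_path_def by auto
  then show "first_vertex P = path_verts P ! 0"
    and "last_vertex P = path_verts P ! length (path_edges P)"
    and "first_vertex P \<in> set (path_verts P)" and "last_vertex P \<in> set (path_verts P)"
    by (auto simp: first_vertex_def last_vertex_def hd_conv_nth last_conv_nth)
qed

lemma is_path_first_eq_last:
  assumes "is_path B P"
  shows "first_vertex P = last_vertex P \<longleftrightarrow> trivial_path P"
  using is_path_first_last[OF assms] assms nth_eq_iff_index_eq[of "path_verts P" 0 "length (path_edges P)"]
  unfolding trivial_path_def is_path_def by auto

lemma XY_path_avoids_inter:
  assumes "XY_path B X Y P" and "\<not> trivial_path P" and "v \<in> set (path_verts P)"
  shows "v \<notin> X \<inter> Y"
proof
  assume "v \<in> X \<inter> Y"
  then have "first_vertex P = last_vertex P"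
    using XY_path_X_iff[OF assms(1,3)] by auto
  then show False
    using is_path_first_eq_last assms(1,2) unfolding XY_path_def by blast
qed

section \<open>The split graph, its matchings, and switching between them\<close>

locale clean_pair =
  fixes B :: "('v, 'e) bidigraph" and X Y :: "'v set"
  assumes fin: "finite_bidirected_graph B"
    and XB: "X \<subseteq> verts B" and YB: "Y \<subseteq> verts B"
    and clean: "\<not> (\<exists>P. is_path B P \<and> \<not> trivial_path P \<and> first_vertex P \<in> X \<and> last_vertex P \<in> X)"
begin

text \<open>A path enters an inner vertex at one sign and leaves it at the other, which is a swap
  between its two nodes. Paths stop at \<open>X \<union> Y\<close>, so the swap is trivial there;
  fixing pairs off the graph makes it a total involution.\<close>

definition flip :: "'v \<times> sign \<Rightarrow> 'v \<times> sign" where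
  "flip w = (if fst w \<in> verts B - (X \<union> Y) then (fst w, opp (snd w)) else w)"

text \<open>Vertices of \<open>X \<union> Y\<close> occur on \<open>X\<close>--\<open>Y\<close> paths only as endpoints, where the signs
  impose no condition; all their half-edges are therefore attached to the node with sign
  \<open>Plus\<close>.\<close>

definition node :: "'e \<Rightarrow> 'v \<Rightarrow> 'v \<times> sign" where
  "node e v = (v, if v \<in> X \<union> Y then Plus else halfsign B e v)"

text \<open>The edges of the split graph. Vertices of \<open>X \<inter> Y\<close> get none, because
  no nontrivial \<open>X\<close>--\<open>Y\<close> path meets them.\<close>

definition joined :: "'v \<times> sign \<Rightarrow> 'v \<times> sign \<Rightarrow> bool" where
  "joined w z \<longleftrightarrow> (\<exists>e \<in> edges B. ends B e = {fst w, fst z} \<and>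
     w = node e (fst w) \<and> z = node e (fst z) \<and> fst w \<notin> X \<inter> Y \<and> fst z \<notin> X \<inter> Y)"

definition linking :: "('v \<times> sign \<Rightarrow> 'v \<times> sign) \<Rightarrow> bool" where
  "linking n \<longleftrightarrow> (\<forall>w. n (n w) = w) \<and> (\<forall>w. n w = w \<longrightarrow> flip w = w) \<and>
     (\<forall>w. n w = flip w \<or> joined w (n w))"

text \<open>The \<open>Plus\<close> node decides because at vertices of \<open>X \<union> Y\<close>
  it carries all half-edges.\<close>

definition covered :: "('v \<times> sign \<Rightarrow> 'v \<times> sign) \<Rightarrow> 'v set \<Rightarrow> 'v set" where
  "covered n S = {v \<in> S. n (v, Plus) \<noteq> (v, Plus)}"

definition switch :: "('v \<times> sign) set \<Rightarrow> ('v \<times> sign \<Rightarrow> 'v \<times> sign) \<Rightarrow> ('v \<times> sign \<Rightarrow> 'v \<times> sign) \<Rightarrow>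
    'v \<times> sign \<Rightarrow> 'v \<times> sign" where
  "switch C p q w = (if w \<in> C then p w else q w)"

lemma flip_flip [simp]: "flip (flip w) = w"
  unfolding flip_def by auto

lemma fst_flip [simp]: "fst (flip w) = fst w"
  unfolding flip_def by auto

lemma fst_node [simp]: "fst (node e v) = v"
  unfolding node_def by simp

lemma flip_fixed_iff: "flip w = w \<longleftrightarrow> fst w \<notin> verts B - (X \<union> Y)"
  unfolding flip_def by (cases w) auto

lemma finite_nodes: "finite (verts B \<times> (UNIV :: sign set))"
  using fin finite_UNIV_sign unfolding finite_bidirected_graph_def by auto

lemma linkingD:
  assumes "linking n"
  shows "n (n w) = w" and "n w = w \<Longrightarrow> flip w = w" and "n w = flip w \<or> joined w (n w)"
  using assms unfolding linking_def by blast+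

lemma invariant_flip: "invariant flip (verts B \<times> UNIV)"
  unfolding invariant_def flip_def by auto

lemma invariant_linking:
  assumes "linking n"
  shows "invariant n (verts B \<times> UNIV)"
  unfolding invariant_def
proof
  fix w :: "'v \<times> sign"
  assume w: "w \<in> verts B \<times> UNIV"
  have "fst (n w) \<in> verts B"
    using linkingD(3)[OF assms, of w]
  proof
    assume "n w = flip w"
    then show ?thesis
      using w by auto
  next
    assume "joined w (n w)"
    then show ?thesis
      using fin unfolding joined_def finite_bidirected_graph_def bidirected_graph_def by blast
  qed
  then show "n w \<in> verts B \<times> UNIV"
    by (cases "n w") auto
qed

text \<open>\<open>p\<close> stays inside \<open>C\<close> and \<open>q\<close> inside its
  complement, so the two pieces do not interfere.\<close>

lemma linking_switch:
  assumes p: "linking p" and q: "linking q" and C: "invariant p C" "invariant q C"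
  shows "linking (switch C p q)"
proof -
  have "invariant q (- C)"
    using invariant_compl[OF linkingD(1)[OF q] C(2)] .
  then have "switch C p q (switch C p q w) = w" for w
    using C linkingD(1)[OF p] linkingD(1)[OF q] unfolding switch_def invariant_def by auto
  then show ?thesis
    using linkingD(2,3)[OF p] linkingD(2,3)[OF q] unfolding linking_def
    by (auto simp: switch_def)
qed

lemma finite_covered: "S \<subseteq> verts B \<Longrightarrow> finite (covered n S)"
  using fin unfolding covered_def finite_bidirected_graph_def by (auto intro: finite_subset)

section \<open>From a linking to disjoint paths\<close>

text \<open>The node set \<open>Z\<close> is kept with the path: its minimality lets two paths be
  compared as orbits, and the sign clause turns a shared vertex of \<open>X \<union> Y\<close> into
  a shared node.\<close>

definition traced :: "('v \<times> sign \<Rightarrow> 'v \<times> sign) \<Rightarrow> ('v, 'e) walk \<Rightarrow> ('v \<times> sign) set \<Rightarrow> bool" where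
  "traced n P Z \<longleftrightarrow> XY_path B X Y P \<and> \<not> trivial_path P \<and> last_vertex P \<in> covered n (Y - X) \<and>
     invariant flip Z \<and> invariant n Z \<and>
     (\<forall>C. invariant flip C \<and> invariant n C \<and> Z \<inter> C \<noteq> {} \<longrightarrow> Z \<subseteq> C) \<and>
     fst ` Z = set (path_verts P) \<and> (\<forall>v t. (v, t) \<in> Z \<and> v \<in> X \<union> Y \<longrightarrow> t = Plus)"

text \<open>The alternating orbit of \<open>flip\<close> and \<open>n\<close> that starts in \<open>x\<close> traces a path of \<open>B\<close>; by
  cleanness of \<open>X\<close> the orbit cannot end in \<open>X\<close>.\<close>

lemma linking_path:
  assumes n: "linking n" and x: "x \<in> covered n (X - Y)"
  obtains P Z where "traced n P Z" and "first_vertex P = x"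
proof -
  have xX: "x \<in> X" "x \<notin> Y" "n (x, Plus) \<noteq> (x, Plus)" "x \<in> verts B"
    using x XB unfolding covered_def by auto
  \<comment> \<open>With \<open>flip\<close> as \<open>f\<close>, steps from even indices follow
    \<open>n\<close> and those from odd indices swap the sign.\<close>
  interpret two_involutions flip n "(x, Plus)"
    by unfold_locales (use linkingD(1)[OF n] xX in \<open>auto simp: flip_def\<close>)
  obtain K where stop: "s (Suc K) = s K" and go: "\<forall>k<K. s (Suc k) \<noteq> s k"
    using alt_stops[OF finite_nodes _ invariant_flip invariant_linking[OF n]] xX by auto
  have inj: "inj_on s {..K}"
    using inj_on_alt[OF go] .
  have inV: "fst (s i) \<in> verts B" for i
  proof (induction i)
    case (Suc i)
    then have "s i \<in> verts B \<times> UNIV"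
      by (cases "s i") auto
    then have "s (Suc i) \<in> verts B \<times> UNIV"
      using invariant_flip invariant_linking[OF n] unfolding invariant_def by auto
    then show ?case by (auto simp del: alt.simps)
  qed (use xX in simp)
  have K0: "0 < K"
    using stop xX by (cases K) auto
  \<comment> \<open>For even \<open>K\<close> the orbit would end at a node fixed by
    \<open>n\<close> but moved by \<open>flip\<close>, which a linking forbids.\<close>
  have oddK: "odd K"
  proof
    assume "even K"
    then have "n (s K) = s K" "flip (s K) \<noteq> s K"
      using stop alt_last_not_fixed[OF stop go K0] by auto
    then show False
      using linkingD(2)[OF n] by blast
  qed
  then obtain l' where "K = 2 * l' + 1" by (rule oddE)
  \<comment> \<open>\<open>l\<close> is the number of edges: the \<open>Suc K\<close> nodes form the
    pairs \<open>s (2 * j)\<close>, \<open>s (Suc (2 * j))\<close>, one for each edge.\<close>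
  then obtain l where l: "Suc K = 2 * l" and l0: "0 < l"
    using that[of "Suc l'"] by auto
  have flipK: "flip (s K) = s K" and nK: "n (s K) \<noteq> s K"
    using stop alt_last_not_fixed[OF stop go K0] oddK by auto
  have inner: "fst (s i) \<notin> X \<union> Y" if "0 < i" "i < K" for i
    using alt_inner_not_fixed(1)[OF stop go that] flip_fixed_iff by auto
  have joined: "joined (s (2 * j)) (s (Suc (2 * j)))" if "j < l" for j
  proof -
    have lt: "2 * j < K"
      using that l by auto
    \<comment> \<open>If \<open>n\<close> agreed with \<open>flip\<close> here, the orbit would step
      straight back to the preceding node; at \<open>j = 0\<close> the start is fixed by
      \<open>flip\<close> but not by \<open>n\<close>.\<close>
    have "n (s (2 * j)) \<noteq> flip (s (2 * j))"
    proof (cases j)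
      case 0
      then show ?thesis
        using xX fx by auto
    next
      case (Suc i)
      have "flip (s (2 * j)) = s (Suc (2 * i))"
        using alt_back[of "Suc (2 * i)"] Suc by simp
      moreover have "s (Suc (2 * i)) \<noteq> s (Suc (2 * j))"
        using inj_onD[OF inj, of "Suc (2 * i)" "Suc (2 * j)"] lt Suc by auto
      ultimately show ?thesis by simp
    qed
    then show ?thesis
      using linkingD(3)[OF n, of "s (2 * j)"] by simp
  qed
  define E where "E j = (SOME e. e \<in> edges B \<and> ends B e = {fst (s (2 * j)), fst (s (Suc (2 * j)))} \<and>
     s (2 * j) = node e (fst (s (2 * j))) \<and> s (Suc (2 * j)) = node e (fst (s (Suc (2 * j)))))" for j
  have E: "E j \<in> edges B" "ends B (E j) = {fst (s (2 * j)), fst (s (Suc (2 * j)))}"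
     "s (2 * j) = node (E j) (fst (s (2 * j)))"
     "s (Suc (2 * j)) = node (E j) (fst (s (Suc (2 * j))))" if "j < l" for j
  proof -
    have "\<exists>e. e \<in> edges B \<and> ends B e = {fst (s (2 * j)), fst (s (Suc (2 * j)))} \<and>
     s (2 * j) = node e (fst (s (2 * j))) \<and> s (Suc (2 * j)) = node e (fst (s (Suc (2 * j))))"
      using joined[OF that] unfolding joined_def by blast
    from someI_ex[OF this] show "E j \<in> edges B" "ends B (E j) = {fst (s (2 * j)), fst (s (Suc (2 * j)))}"
     "s (2 * j) = node (E j) (fst (s (2 * j)))"
     "s (Suc (2 * j)) = node (E j) (fst (s (Suc (2 * j))))"
      unfolding E_def by blast+
  qed
  \<comment> \<open>The truncated \<open>2 * j - 1\<close> gives \<open>s 0\<close> for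
    \<open>j = 0\<close>; otherwise it selects the node at which the vertex is entered, so
    \<open>V l\<close> belongs to the last node \<open>s K\<close>.\<close>
  define V where "V j = fst (s (2 * j - 1))" for j
  have V_even: "V j = fst (s (2 * j))" if "j < l" for j
    by (cases j) (auto simp: V_def)
  have V_odd: "V (Suc j) = fst (s (Suc (2 * j)))" for j
    by (simp add: V_def)
  have "2 * l - 1 = K"
    using l by simp
  then have V0: "V 0 = x" and Vl: "V l = fst (s K)"
    by (auto simp: V_def simp del: alt.simps(2))
  have V_inner: "V j \<notin> X \<union> Y" if "0 < j" "j < l" for j
    unfolding V_def by (rule inner) (use that l in auto)
  have last_XY: "V l \<in> X \<union> Y" "V l \<notin> X \<inter> Y" "s K = (V l, Plus)"
  proof -
    show 1: "V l \<in> X \<union> Y"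
      using flipK inV flip_fixed_iff Vl by auto
    have K: "K = Suc (2 * (l - 1))"
      using l l0 by auto
    show "V l \<notin> X \<inter> Y" "s K = (V l, Plus)"
      using joined[of "l - 1"] l0 1 Vl unfolding joined_def node_def K by auto
  qed
  have V_inj: "V i \<noteq> V j" if "i < j" "j \<le> l" for i j
  proof
    assume eq: "V i = V j"
    show False
    proof (cases "j = l")
      case True
      then have "i = 0"
        using eq last_XY(1) V_inner[of i] that by auto
      then have "s 0 = s K"
        using eq True last_XY(3) V0 by simp
      then show False
        using inj_onD[OF inj, of 0 K] K0 by auto
    next
      case False
      then have "V i \<notin> X \<union> Y"
        using eq V_inner[of j] that by auto
      then have i0: "i \<noteq> 0"
        using V0 xX by (metis UnI1)
      \<comment> \<open>The two nodes of the inner vertex \<open>V i\<close> are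
        \<open>s (2 * i - 1)\<close> and \<open>s (2 * i)\<close>, so a repeated vertex repeats a
        node of the orbit.\<close>
      have "flip (s (2 * i - 1)) = s (2 * i)"
        using i0 by (cases i) auto
      moreover have "s (2 * j - 1) = s (2 * i - 1) \<or> s (2 * j - 1) = flip (s (2 * i - 1))"
        using eq inV[of "2 * i - 1"] \<open>V i \<notin> X \<union> Y\<close>
        by (cases "s (2 * j - 1)"; cases "s (2 * i - 1)") (auto simp: V_def flip_def neq_sign_iff)
      ultimately have "s (2 * j - 1) = s (2 * i - 1) \<or> s (2 * j - 1) = s (2 * i)"
        by simp
      moreover have "2 * j - 1 \<le> K" "2 * i - 1 \<le> K" "2 * i \<le> K"
        "2 * j - 1 \<noteq> 2 * i - 1" "2 * j - 1 \<noteq> 2 * i"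
        using that i0 l by presburger+
      ultimately show False
        using inj_on_eq_iff[OF inj] by auto
    qed
  qed
  define P where "P = (map V [0..<Suc l], map E [0..<l])"
  have Pv: "path_verts P ! i = V i" if "i \<le> l" for i
    using that unfolding P_def by (simp del: upt_Suc)
  have Pe: "path_edges P ! i = E i" if "i < l" for i
    using that unfolding P_def by simp
  have Pset: "set (path_verts P) = V ` {..l}"
    unfolding P_def by (simp del: upt_Suc add: atLeast0LessThan lessThan_Suc_atMost)
  have first: "first_vertex P = x"
    unfolding first_vertex_def P_def using V0 by (simp del: upt_Suc add: upt_conv_Cons)
  have last: "last_vertex P = V l"
    unfolding last_vertex_def P_def by simp
  have nontriv: "\<not> trivial_path P"
    unfolding trivial_path_def P_def using l0 by simp
  have E_ends: "ends B (E i) = {V i, V (Suc i)}" if "i < l" for i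
    using E(2)[OF that] V_even[OF that] V_odd[of i] by simp
  have path: "is_path B P"
    unfolding is_path_def
  proof (intro conjI allI impI)
    show "length (path_verts P) = Suc (length (path_edges P))"
      unfolding P_def by simp
    show "set (path_verts P) \<subseteq> verts B"
      unfolding Pset V_def using inV by auto
    show "set (path_edges P) \<subseteq> edges B"
      unfolding P_def using E(1) by auto
    have "inj_on V {0..<Suc l}"
      by (rule linorder_inj_onI') (use V_inj in auto)
    then show "distinct (path_verts P)"
      unfolding P_def by (simp del: upt_Suc add: distinct_map)
    have "inj_on E {0..<l}"
    proof (rule linorder_inj_onI')
      fix i j assume ij: "i \<in> {0..<l}" "j \<in> {0..<l}" "i < j"
      then have "V i \<noteq> V j" "V i \<noteq> V (Suc j)"
        using V_inj by auto
      then show "E i \<noteq> E j"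
        using E_ends[of i] E_ends[of j] ij by auto
    qed
    then show "distinct (path_edges P)"
      unfolding P_def by (simp add: distinct_map)
  next
    fix i assume "i < length (path_edges P)"
    then have "i < l" unfolding P_def by simp
    then show "ends B (path_edges P ! i) = {path_verts P ! i, path_verts P ! Suc i}"
      using E_ends Pv Pe by simp
  next
    fix i assume "1 \<le> i \<and> i < length (path_edges P)"
    then have i: "0 < i" "i < l" unfolding P_def by auto
    obtain j where j: "i = Suc j"
      using i gr0_implies_Suc by blast
    have notXY: "V i \<notin> X \<union> Y" using V_inner i by simp
    have a: "s (2 * i) = (V i, halfsign B (E i) (V i))"
      using E(3)[of i] V_even[of i] i notXY unfolding node_def by simp
    have b: "s (Suc (2 * j)) = (V i, halfsign B (E j) (V i))"
      using E(4)[of j] V_odd[of j] i j notXY unfolding node_def by simp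
    have "s (2 * i) = flip (s (Suc (2 * j)))"
      using j by simp
    also have "\<dots> = (V i, opp (halfsign B (E j) (V i)))"
      unfolding b flip_def using notXY inV[of "2 * i"] a by auto
    finally show "halfsign B (path_edges P ! i) (path_verts P ! i) =
          opp (halfsign B (path_edges P ! (i - 1)) (path_verts P ! i))"
      using a i j Pv Pe by simp
  qed
  have lastY: "V l \<in> Y - X"
  proof -
    have "last_vertex P \<notin> X"
      using clean path nontriv first xX(1) by blast
    then show ?thesis
      using last last_XY(1) by auto
  qed
  have meetX: "v = x" if "v \<in> V ` {..l}" "v \<in> X" for v
  proof -
    obtain j where j: "v = V j" "j \<le> l" using \<open>v \<in> V ` {..l}\<close> by auto
    then have "j \<noteq> l" using \<open>v \<in> X\<close> lastY by auto
    then have "j = 0" using \<open>v \<in> X\<close> j V_inner[of j] by auto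
    then show ?thesis using j V0 by simp
  qed
  have meetY: "v = V l" if "v \<in> V ` {..l}" "v \<in> Y" for v
  proof -
    obtain j where j: "v = V j" "j \<le> l" using \<open>v \<in> V ` {..l}\<close> by auto
    then have "j \<noteq> 0" using \<open>v \<in> Y\<close> xX(2) V0 by metis
    then have "\<not> j < l" using \<open>v \<in> Y\<close> j(1) V_inner[of j] by auto
    then show ?thesis using j by simp
  qed
  have XY: "XY_path B X Y P"
    unfolding XY_path_def first last Pset
    using path meetX meetY xX lastY V0 by auto
  have "traced n P (s ` {..K})"
    unfolding traced_def
  proof (intro conjI allI impI)
    show "last_vertex P \<in> covered n (Y - X)"
      unfolding last covered_def using lastY nK last_XY(3) by simp
    show "invariant flip (s ` {..K})" "invariant n (s ` {..K})"
      using invariant_orbit[OF stop go] .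
    show "s ` {..K} \<subseteq> C" if "invariant flip C \<and> invariant n C \<and> s ` {..K} \<inter> C \<noteq> {}" for C
      using orbit_minimal[OF stop go, of C] that by blast
    show "fst ` s ` {..K} = set (path_verts P)"
      unfolding Pset
    proof
      show "fst ` s ` {..K} \<subseteq> V ` {..l}"
      proof clarsimp
        fix i assume "i \<le> K"
        show "fst (s i) \<in> V ` {..l}"
        proof (cases "even i")
          case True
          then obtain j where j: "i = 2 * j" by blast
          then have "j < l" using \<open>i \<le> K\<close> l by simp
          then have "fst (s i) = V j" "j \<le> l" using V_even[of j] j by auto
          then show ?thesis by blast
        next
          case False
          then obtain j where j: "i = 2 * j + 1" by (rule oddE)
          then have "Suc j \<le> l" using \<open>i \<le> K\<close> l by simp
          moreover have "fst (s i) = V (Suc j)" using V_odd[of j] j by simp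
          ultimately show ?thesis by blast
        qed
      qed
      show "V ` {..l} \<subseteq> fst ` s ` {..K}"
        unfolding V_def using l by force
    qed
    show "t = Plus" if vt: "(v, t) \<in> s ` {..K} \<and> v \<in> X \<union> Y" for v t
    proof -
      obtain i where i: "i \<le> K" "s i = (v, t)"
        using vt by auto
      then have "fst (s i) \<in> X \<union> Y"
        using vt by simp
      then have "i = 0 \<or> i = K"
        using inner[of i] i(1) by linarith
      then show ?thesis
        using i last_XY(3) by auto
    qed
  qed (use XY nontriv in auto)
  then show thesis
    using that first by blast
qed

text \<open>If two paths meet, one orbit lies in the other, so the first vertex of one lies on the
  other path, which meets \<open>X\<close> only in its own first vertex. The inclusion for last
  vertices can be strict, since an orbit may join two vertices of \<open>Y\<close>.\<close>

lemma linking_disjoint_paths: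
  assumes n: "linking n"
  obtains \<R> where "disjoint_XY_paths B X Y \<R>" and "\<forall>R \<in> \<R>. \<not> trivial_path R"
    and "first_vertex ` \<R> = covered n (X - Y)" and "last_vertex ` \<R> \<subseteq> covered n (Y - X)"
proof -
  have "\<exists>P Z. traced n P Z \<and> first_vertex P = x" if "x \<in> covered n (X - Y)" for x
    by (rule linking_path[OF n that]) blast
  then obtain P Z where PO: "\<And>x. x \<in> covered n (X - Y) \<Longrightarrow> traced n (P x) (Z x)"
    and first: "\<And>x. x \<in> covered n (X - Y) \<Longrightarrow> first_vertex (P x) = x"
    by metis
  have disj: "set (path_verts (P x)) \<inter> set (path_verts (P x')) = {}"
    if x: "x \<in> covered n (X - Y)" "x' \<in> covered n (X - Y)" "x \<noteq> x'" for x x'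
  proof (rule ccontr)
    have paths: "XY_path B X Y (P x)" "XY_path B X Y (P x')"
      and inv: "invariant flip (Z x')" "invariant n (Z x')"
      and minimal: "Z x \<inter> Z x' \<noteq> {} \<Longrightarrow> Z x \<subseteq> Z x'"
      and Z: "fst ` Z x = set (path_verts (P x))" "fst ` Z x' = set (path_verts (P x'))"
      and Plus: "\<And>v t. (v, t) \<in> Z x \<Longrightarrow> v \<in> X \<union> Y \<Longrightarrow> t = Plus"
        "\<And>v t. (v, t) \<in> Z x' \<Longrightarrow> v \<in> X \<union> Y \<Longrightarrow> t = Plus"
      using PO[OF x(1)] PO[OF x(2)] unfolding traced_def by simp_all
    assume "set (path_verts (P x)) \<inter> set (path_verts (P x')) \<noteq> {}"
    then obtain v where "v \<in> fst ` Z x" "v \<in> fst ` Z x'"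
      unfolding Z by blast
    then obtain t t' where v: "(v, t) \<in> Z x" "(v, t') \<in> Z x'"
      by force
    have "v \<in> verts B"
      using paths(1) imageI[OF v(1), of fst] unfolding Z XY_path_def is_path_def by auto
    \<comment> \<open>On \<open>X \<union> Y\<close> both signs are \<open>Plus\<close>; elsewhere
      \<open>Z x'\<close> contains both nodes of \<open>v\<close> by \<open>flip\<close>.\<close>
    have "(v, t) \<in> Z x'"
    proof (cases "v \<in> X \<union> Y")
      case True
      then show ?thesis using Plus v by metis
    next
      case False
      then have "flip (v, t') = (v, opp t')"
        using \<open>v \<in> verts B\<close> unfolding flip_def by simp
      then have "(v, opp t') \<in> Z x'"
        using inv(1) v(2) unfolding invariant_def by fastforce
      then show ?thesis
        using v(2) neq_sign_iff[of t t'] by auto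
    qed
    then have "Z x \<subseteq> Z x'"
      using minimal v(1) by blast
    then have "set (path_verts (P x)) \<subseteq> set (path_verts (P x'))"
      unfolding Z[symmetric] by (rule image_mono)
    moreover have "x \<in> set (path_verts (P x))"
      using paths(1) is_path_first_last(3)[of B "P x"] first[OF x(1)] unfolding XY_path_def by simp
    ultimately have "x \<in> set (path_verts (P x'))"
      by blast
    then have "x = x'"
      using XY_path_X_iff(1)[OF paths(2), of x] first[OF x(2)] x(1) unfolding covered_def by simp
    then show False using x(3) by simp
  qed
  show thesis
  proof (rule that[of "P ` covered n (X - Y)"])
    have "XY_path B X Y (P x)" if "x \<in> covered n (X - Y)" for x
      using PO[OF that] unfolding traced_def by simp
    moreover have "set (path_verts (P x)) \<inter> set (path_verts (P x')) = {}"
      if "x \<in> covered n (X - Y)" "x' \<in> covered n (X - Y)" "P x \<noteq> P x'" for x x'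
      using disj[of x x'] that by blast
    ultimately show "disjoint_XY_paths B X Y (P ` covered n (X - Y))"
      unfolding disjoint_XY_paths_def pairwise_def by simp
    show "first_vertex ` P ` covered n (X - Y) = covered n (X - Y)"
      using first by (simp add: image_image)
    show "\<forall>R \<in> P ` covered n (X - Y). \<not> trivial_path R"
      using PO unfolding traced_def by blast
    show "last_vertex ` P ` covered n (X - Y) \<subseteq> covered n (Y - X)"
      using PO unfolding traced_def by blast
  qed
qed

section \<open>Counting covered vertices\<close>

lemma disjoint_paths_inj:
  assumes "disjoint_XY_paths B X Y \<R>"
  shows "inj_on first_vertex \<R>" and "inj_on last_vertex \<R>"
proof -
  have eq: "R = R'" if "R \<in> \<R>" "R' \<in> \<R>" "v \<in> set (path_verts R)" "v \<in> set (path_verts R')" for R R' v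
    using assms that unfolding disjoint_XY_paths_def pairwise_def by blast
  have path: "is_path B R" if "R \<in> \<R>" for R
    using assms that unfolding disjoint_XY_paths_def XY_path_def by blast
  show "inj_on first_vertex \<R>"
  proof (rule inj_onI)
    fix R R' assume R: "R \<in> \<R>" "R' \<in> \<R>" "first_vertex R = first_vertex R'"
    show "R = R'"
      using eq[OF R(1,2) is_path_first_last(3)[OF path[OF R(1)]]]
        is_path_first_last(3)[OF path[OF R(2)]] R(3) by simp
  qed
  show "inj_on last_vertex \<R>"
  proof (rule inj_onI)
    fix R R' assume R: "R \<in> \<R>" "R' \<in> \<R>" "last_vertex R = last_vertex R'"
    show "R = R'"
      using eq[OF R(1,2) is_path_first_last(4)[OF path[OF R(1)]]]
        is_path_first_last(4)[OF path[OF R(2)]] R(3) by simp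
  qed
qed

text \<open>Every covered vertex of \<open>X - Y\<close> starts a path of the linking, and disjoint
  paths have distinct last vertices.\<close>

lemma card_covered_le:
  assumes "linking n"
  shows "card (covered n (X - Y)) \<le> card (covered n (Y - X))"
proof -
  obtain \<R> where R: "disjoint_XY_paths B X Y \<R>" "\<forall>R \<in> \<R>. \<not> trivial_path R"
    "first_vertex ` \<R> = covered n (X - Y)" "last_vertex ` \<R> \<subseteq> covered n (Y - X)"
    using linking_disjoint_paths[OF assms] by blast
  have "card (covered n (X - Y)) = card (last_vertex ` \<R>)"
    unfolding R(3)[symmetric] using disjoint_paths_inj[OF R(1)] by (simp add: card_image)
  also have "\<dots> \<le> card (covered n (Y - X))"
    by (rule card_mono[OF finite_covered R(4)]) (use YB in blast)
  finally show ?thesis .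
qed

text \<open>For a linking this is equality in \<open>card_covered_le\<close>: every covered vertex
  of \<open>Y - X\<close> then ends a path that starts in \<open>X - Y\<close>.\<close>

definition balanced :: "('v \<times> sign \<Rightarrow> 'v \<times> sign) \<Rightarrow> bool" where
  "balanced n \<longleftrightarrow> card (covered n (X - Y)) = card (covered n (Y - X))"

text \<open>On \<open>C\<close> and on its complement alike, one of the two switches follows
  \<open>p\<close> and the other \<open>q\<close>.\<close>

lemma card_covered_switch:
  assumes "S \<subseteq> verts B"
  shows "card (covered (switch C p q) S) + card (covered (switch (- C) p q) S) =
    card (covered p S) + card (covered q S)"
proof -
  let ?D = "{v. (v, Plus) \<in> C}"
  have 1: "card (covered (switch C p q) S) = card (covered p S \<inter> ?D) + card (covered q S - ?D)"
  proof -
    have "covered (switch C p q) S = (covered p S \<inter> ?D) \<union> (covered q S - ?D)"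
      unfolding covered_def switch_def by auto
    then show ?thesis
      using card_Un_disjoint[of "covered p S \<inter> ?D" "covered q S - ?D"] finite_covered[OF assms] by auto
  qed
  have 2: "card (covered (switch (- C) p q) S) = card (covered q S \<inter> ?D) + card (covered p S - ?D)"
  proof -
    have "covered (switch (- C) p q) S = (covered q S \<inter> ?D) \<union> (covered p S - ?D)"
      unfolding covered_def switch_def by auto
    then show ?thesis
      using card_Un_disjoint[of "covered q S \<inter> ?D" "covered p S - ?D"] finite_covered[OF assms] by auto
  qed
  have "card (covered n S) = card (covered n S \<inter> ?D) + card (covered n S - ?D)" for n
    using finite_covered[OF assms] by (metis card_Int_Diff)
  from this[of p] this[of q] 1 2 show ?thesis by simp
qed

text \<open>Neither of the two complementary switches can cover more of \<open>X\<close> than of \<open>Y\<close>, while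
  together they are balanced.\<close>

lemma balanced_switch:
  assumes p: "linking p" "balanced p" and q: "linking q" "balanced q"
    and C: "invariant p C" "invariant q C"
  shows "balanced (switch C p q)"
proof -
  have "linking (switch C p q)" "linking (switch (- C) p q)"
    using linking_switch[OF p(1) q(1)] C invariant_compl[OF linkingD(1)[OF p(1)]]
      invariant_compl[OF linkingD(1)[OF q(1)]] by auto
  then have "card (covered (switch C p q) (X - Y)) \<le> card (covered (switch C p q) (Y - X))"
    "card (covered (switch (- C) p q) (X - Y)) \<le> card (covered (switch (- C) p q) (Y - X))"
    using card_covered_le by auto
  moreover have "X - Y \<subseteq> verts B" "Y - X \<subseteq> verts B"
    using XB YB by auto
  note card_covered_switch[OF this(1), of C p q] card_covered_switch[OF this(2), of C p q]
  ultimately show ?thesis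
    using p(2) q(2) unfolding balanced_def by linarith
qed

text \<open>An orbit joining \<open>a\<close> to a vertex \<open>b\<close> of \<open>Y\<close> covered by \<open>q\<close> alone would yield, after
  switching, a linking that covers one more vertex of \<open>X\<close> and one vertex less of \<open>Y\<close> than \<open>q\<close>.\<close>

lemma exchange_orbit:
  assumes p: "linking p" "balanced p" and q: "linking q" "balanced q"
    and a: "a \<in> covered p (X - Y) - covered q (X - Y)"
  obtains Z where "invariant p Z" and "invariant q Z" and "(a, Plus) \<in> Z"
    and "\<And>b. b \<in> covered q (Y - X) - covered p (Y - X) \<Longrightarrow> (b, Plus) \<notin> Z"
proof -
  have aX: "a \<in> X" "a \<notin> Y" "p (a, Plus) \<noteq> (a, Plus)" "q (a, Plus) = (a, Plus)" "a \<in> verts B"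
    using a XB unfolding covered_def by auto
  \<comment> \<open>\<open>a\<close> is fixed by \<open>q\<close> and moved by \<open>p\<close>, so
    it is an end of its joint orbit and the first step is by \<open>p\<close>.\<close>
  interpret two_involutions q p "(a, Plus)"
    by unfold_locales (use linkingD(1)[OF p(1)] linkingD(1)[OF q(1)] aX in auto)
  obtain K where stop: "s (Suc K) = s K" and go: "\<forall>k<K. s (Suc k) \<noteq> s k"
    using alt_stops[OF finite_nodes _ invariant_linking[OF q(1)] invariant_linking[OF p(1)]] aX by auto
  let ?Z = "s ` {..K}"
  have inv: "invariant q ?Z" "invariant p ?Z"
    using invariant_orbit[OF stop go] .
  have a0: "(a, Plus) \<in> ?Z"
    by (rule image_eqI[of _ _ 0]) auto
  have "(b, Plus) \<notin> ?Z" if b: "b \<in> covered q (Y - X) - covered p (Y - X)" for b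
  proof
    assume "(b, Plus) \<in> ?Z"
    have bY: "b \<in> Y" "b \<notin> X" "q (b, Plus) \<noteq> (b, Plus)" "p (b, Plus) = (b, Plus)"
      using b unfolding covered_def by auto
    obtain i where i: "i \<le> K" "s i = (b, Plus)"
      using \<open>(b, Plus) \<in> ?Z\<close> by auto
    have "i \<noteq> 0"
      using i aX bY by (cases i) auto
    \<comment> \<open>\<open>b\<close> is fixed by \<open>p\<close>, hence not inner: it is the
      other end of the orbit.\<close>
    then have iK: "i = K"
      using alt_inner_not_fixed(2)[OF stop go, of i] i bY by (cases "i < K") auto
    \<comment> \<open>All other nodes of the orbit are inner and moved by both involutions, so the
      switch changes coverage only at \<open>a\<close> and \<open>b\<close>.\<close>
    have others: "p w \<noteq> w" "q w \<noteq> w" if w: "w \<in> ?Z" "w \<noteq> (a, Plus)" "w \<noteq> (b, Plus)" for w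
    proof -
      obtain j where j: "j \<le> K" "w = s j" using \<open>w \<in> ?Z\<close> by auto
      then have "j \<noteq> 0" "j \<noteq> K"
        using w i iK by (auto intro: gr0I)
      then show "p w \<noteq> w" "q w \<noteq> w"
        using alt_inner_not_fixed[OF stop go, of j] j by auto
    qed
    let ?n = "switch ?Z p q"
    have "covered ?n (X - Y) = insert a (covered q (X - Y))"
    proof -
      have "?n (v, Plus) \<noteq> (v, Plus) \<longleftrightarrow> v = a \<or> q (v, Plus) \<noteq> (v, Plus)" if "v \<in> X - Y" for v
        using others[of "(v, Plus)"] that aX bY a0 unfolding switch_def by auto
      then show ?thesis
        using aX unfolding covered_def by auto
    qed
    moreover have "finite (covered q (X - Y))"
      using finite_covered XB by blast
    ultimately have cardX: "card (covered ?n (X - Y)) = Suc (card (covered q (X - Y)))"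
      using a by simp
    have "covered ?n (Y - X) = covered q (Y - X) - {b}"
    proof -
      have "?n (v, Plus) \<noteq> (v, Plus) \<longleftrightarrow> v \<noteq> b \<and> q (v, Plus) \<noteq> (v, Plus)" if "v \<in> Y - X" for v
        using others[of "(v, Plus)"] that aX bY \<open>(b, Plus) \<in> ?Z\<close> unfolding switch_def by auto
      then show ?thesis
        unfolding covered_def by auto
    qed
    then have "card (covered ?n (Y - X)) \<le> card (covered q (Y - X))"
      by (simp add: card_Diff1_le)
    moreover have "balanced ?n"
      using balanced_switch[OF p q] inv by simp
    ultimately show False
      using cardX q(2) unfolding balanced_def by simp
  qed
  then show thesis
    using that inv a0 by blast
qed

section \<open>Exchange of linkings and the return to paths\<close>

text \<open>\<open>C\<close> is the largest jointly invariant set avoiding the vertices of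
  \<open>Y - X\<close> covered by \<open>q\<close> alone, so switching on it uncovers nothing of
  \<open>q\<close> in \<open>Y - X\<close>. By \<open>exchange_orbit\<close> it contains every
  vertex of \<open>X - Y\<close> covered by \<open>p\<close> alone.\<close>

lemma exchange:
  assumes p: "linking p" "balanced p" and q: "linking q" "balanced q"
  obtains n where "linking n" and "balanced n"
    and "covered p (X - Y) \<subseteq> covered n (X - Y)" and "covered q (Y - X) \<subseteq> covered n (Y - X)"
proof -
  define good where "good Z \<longleftrightarrow> invariant p Z \<and> invariant q Z \<and>
    (\<forall>b \<in> covered q (Y - X) - covered p (Y - X). (b, Plus) \<notin> Z)" for Z
  define C where "C = \<Union> {Z. good Z}"
  have C: "invariant p C" "invariant q C"
    unfolding C_def good_def by (rule invariant_Union; simp)+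
  have bC: "(b, Plus) \<notin> C" if "b \<in> covered q (Y - X)" "b \<notin> covered p (Y - X)" for b
    using that unfolding C_def good_def by blast
  have aC: "(a, Plus) \<in> C" if "a \<in> covered p (X - Y)" "a \<notin> covered q (X - Y)" for a
  proof -
    have "a \<in> covered p (X - Y) - covered q (X - Y)"
      using that by blast
    from exchange_orbit[OF p q this] obtain Z where "good Z" "(a, Plus) \<in> Z"
      unfolding good_def by metis
    then show ?thesis
      unfolding C_def by blast
  qed
  show thesis
  proof (rule that[of "switch C p q"])
    show "linking (switch C p q)" "balanced (switch C p q)"
      using linking_switch[OF p(1) q(1) C] balanced_switch[OF p q C] .
    show "covered p (X - Y) \<subseteq> covered (switch C p q) (X - Y)"
      using aC unfolding covered_def switch_def by auto
    show "covered q (Y - X) \<subseteq> covered (switch C p q) (Y - X)"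
      using bC unfolding covered_def switch_def by auto
  qed
qed

text \<open>Balance turns the inclusion of last vertices into equality by counting. The trivial
  paths at \<open>X \<inter> Y\<close> can be added because nontrivial
  \<open>X\<close>--\<open>Y\<close> paths avoid that set.\<close>

lemma balanced_disjoint_paths:
  assumes n: "linking n" "balanced n"
  obtains \<R> where "disjoint_XY_paths B X Y \<R>"
    and "first_vertex ` \<R> = covered n (X - Y) \<union> (X \<inter> Y)"
    and "last_vertex ` \<R> = covered n (Y - X) \<union> (X \<inter> Y)"
proof -
  obtain \<R> where R: "disjoint_XY_paths B X Y \<R>" "\<forall>R \<in> \<R>. \<not> trivial_path R"
    "first_vertex ` \<R> = covered n (X - Y)" "last_vertex ` \<R> \<subseteq> covered n (Y - X)"
    using linking_disjoint_paths[OF n(1)] by blast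
  have "card (last_vertex ` \<R>) = card (first_vertex ` \<R>)"
    using disjoint_paths_inj[OF R(1)] by (simp add: card_image)
  then have "card (last_vertex ` \<R>) = card (covered n (Y - X))"
    using R(3) n(2) unfolding balanced_def by simp
  then have last: "last_vertex ` \<R> = covered n (Y - X)"
    by (intro card_subset_eq[OF finite_covered R(4)]) (use YB in blast)+
  let ?T = "(\<lambda>x. ([x], [])) ` (X \<inter> Y) :: ('v, 'e) walk set"
  have T: "XY_path B X Y P" if "P \<in> ?T" for P
    using that XB unfolding XY_path_def is_path_def first_vertex_def last_vertex_def by auto
  have RT: "\<forall>R \<in> \<R>. \<forall>v \<in> X \<inter> Y. v \<notin> set (path_verts R)"
    using XY_path_avoids_inter[of B X Y] R(1,2) unfolding disjoint_XY_paths_def by blast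
  show thesis
  proof (rule that[of "\<R> \<union> ?T"])
    have "pairwise (\<lambda>P Q. set (path_verts P) \<inter> set (path_verts Q) = {}) ?T"
      unfolding pairwise_def by auto
    then show "disjoint_XY_paths B X Y (\<R> \<union> ?T)"
      using R(1) T RT unfolding disjoint_XY_paths_def pairwise_def
      by (simp add: ball_Un)
    show "first_vertex ` (\<R> \<union> ?T) = covered n (X - Y) \<union> (X \<inter> Y)"
      unfolding image_Un R(3) by (simp add: image_image first_vertex_def)
    show "last_vertex ` (\<R> \<union> ?T) = covered n (Y - X) \<union> (X \<inter> Y)"
      unfolding image_Un last by (simp add: image_image last_vertex_def)
  qed
qed

section \<open>From disjoint paths to a linking\<close>

text \<open>A first vertex in \<open>Y\<close> is also the last vertex, and a last vertex in
  \<open>X\<close> is also the first, so these ends come exactly from the trivial paths.\<close>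

lemma nontrivial_ends:
  assumes D: "disjoint_XY_paths B X Y \<P>"
  shows "first_vertex ` {P \<in> \<P>. \<not> trivial_path P} = first_vertex ` \<P> - Y"
    and "last_vertex ` {P \<in> \<P>. \<not> trivial_path P} = last_vertex ` \<P> - X"
proof -
  have "first_vertex P \<in> Y \<longleftrightarrow> trivial_path P" "last_vertex P \<in> X \<longleftrightarrow> trivial_path P"
    if "P \<in> \<P>" for P
  proof -
    have "XY_path B X Y P" "is_path B P"
      using D that unfolding disjoint_XY_paths_def XY_path_def by auto
    then show "first_vertex P \<in> Y \<longleftrightarrow> trivial_path P" "last_vertex P \<in> X \<longleftrightarrow> trivial_path P"
      using XY_path_X_iff is_path_first_last(3,4) is_path_first_eq_last by metis+
  qed
  then show "first_vertex ` {P \<in> \<P>. \<not> trivial_path P} = first_vertex ` \<P> - Y"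
    and "last_vertex ` {P \<in> \<P>. \<not> trivial_path P} = last_vertex ` \<P> - X"
    by auto
qed

text \<open>Each path edge matches the nodes of its two half-edges, and all other nodes follow
  \<open>flip\<close>. Balance holds because both covered sets are in bijection with the nontrivial
  paths.\<close>

lemma disjoint_paths_linking:
  assumes D: "disjoint_XY_paths B X Y \<P>"
  obtains p where "linking p" and "balanced p"
    and "covered p (X - Y) = first_vertex ` \<P> - Y" and "covered p (Y - X) = last_vertex ` \<P> - X"
proof -
  have XYp: "XY_path B X Y P" and path: "is_path B P" if "P \<in> \<P>" for P
    using D that unfolding disjoint_XY_paths_def XY_path_def by auto
  \<comment> \<open>The node of edge number \<open>i\<close> at vertex number \<open>k\<close>; with
    edges numbered from 0, the ends of the edge are \<open>k = i\<close> and
    \<open>k = Suc i\<close>.\<close>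
  define half where "half P i k = node (path_edges P ! i) (path_verts P ! k)" for P i k
  have fst_half: "fst (half P i k) = path_verts P ! k" for P i k
    unfolding half_def node_def by simp
  have vert_in: "path_verts P ! k \<in> set (path_verts P)" if "P \<in> \<P>" "k \<le> length (path_edges P)" for P k
    using path[OF that(1)] that(2) unfolding is_path_def by auto
  have vert_inj: "k = k'" if "P \<in> \<P>" "k \<le> length (path_edges P)" "k' \<le> length (path_edges P)"
    "path_verts P ! k = path_verts P ! k'" for P k k'
    using path[OF that(1)] that(2-4) nth_eq_iff_index_eq[of "path_verts P" k k']
    unfolding is_path_def by auto
  have inner: "path_verts P ! k \<notin> X \<union> Y" if P: "P \<in> \<P>" and k: "0 < k" "k < length (path_edges P)" for P k
  proof
    assume "path_verts P ! k \<in> X \<union> Y"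
    then have "path_verts P ! k = path_verts P ! 0 \<or> path_verts P ! k = path_verts P ! length (path_edges P)"
      using XY_path_X_iff[OF XYp[OF P] vert_in[OF P, of k]] k is_path_first_last(1,2)[OF path[OF P]] by auto
    then show False
      using vert_inj[OF P, of k 0] vert_inj[OF P, of k "length (path_edges P)"] k by auto
  qed
  \<comment> \<open>By the sign condition of a path, the two half-edges at an inner vertex use its
    two different nodes.\<close>
  have flip_half: "flip (half P i (Suc i)) = half P (Suc i) (Suc i)"
    "half P i (Suc i) \<noteq> half P (Suc i) (Suc i)"
    if P: "P \<in> \<P>" and i: "Suc i < length (path_edges P)" for P i
  proof -
    let ?v = "path_verts P ! Suc i"
    have v: "?v \<notin> X \<union> Y" "?v \<in> verts B"
      using inner[OF P, of "Suc i"] i vert_in[OF P, of "Suc i"] path[OF P] unfolding is_path_def by auto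
    have "\<forall>i. 1 \<le> i \<and> i < length (path_edges P) \<longrightarrow>
        halfsign B (path_edges P ! i) (path_verts P ! i) =
          opp (halfsign B (path_edges P ! (i - 1)) (path_verts P ! i))"
      using path[OF P] unfolding is_path_def by blast
    from this[rule_format, of "Suc i"] i
    have "halfsign B (path_edges P ! Suc i) ?v = opp (halfsign B (path_edges P ! i) ?v)"
      by simp
    then show "flip (half P i (Suc i)) = half P (Suc i) (Suc i)"
      "half P i (Suc i) \<noteq> half P (Suc i) (Suc i)"
      using v unfolding half_def node_def flip_def by auto
  qed
  \<comment> \<open>A shared vertex forces the same path and position by disjointness; consecutive
    edges use different nodes there, so the edge agrees too.\<close>
  have half_inj: "P = P' \<and> i = i' \<and> k = k'"
    if P: "P \<in> \<P>" "P' \<in> \<P>" and i: "i < length (path_edges P)" "i' < length (path_edges P')"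
      and k: "k = i \<or> k = Suc i" "k' = i' \<or> k' = Suc i'" and eq: "half P i k = half P' i' k'"
    for P P' i i' k k'
  proof -
    have v: "path_verts P ! k = path_verts P' ! k'"
      using eq fst_half by metis
    have "path_verts P ! k \<in> set (path_verts P)" "path_verts P' ! k' \<in> set (path_verts P')"
      by (rule vert_in; use P i k in linarith)+
    then have PP: "P = P'"
      using v D P unfolding disjoint_XY_paths_def pairwise_def by auto
    then have kk: "k = k'"
      using vert_inj[OF P(1), of k k'] v i k by auto
    have "i = i'"
    proof (rule ccontr)
      assume "i \<noteq> i'"
      then consider "i' = Suc i" "k = Suc i" | "i = Suc i'" "k = Suc i'"
        using k kk by auto
      then show False
      proof cases
        case 1
        then show False
          using flip_half(2)[OF P(1), of i] i(2) eq unfolding PP kk by simp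
      next
        case 2
        then show False
          using flip_half(2)[OF P(1), of i'] i(1) eq unfolding PP kk by simp
      qed
    qed
    then show ?thesis using PP kk by simp
  qed
  define R where "R w z \<longleftrightarrow> (\<exists>P \<in> \<P>. \<exists>i < length (path_edges P).
     w = half P i i \<and> z = half P i (Suc i) \<or> w = half P i (Suc i) \<and> z = half P i i)" for w z
  have R_sym: "R z w" if "R w z" for w z
    using that unfolding R_def by blast
  have R_unique: "z = z'" if "R w z" "R w z'" for w z z'
  proof -
    obtain P i k where P: "P \<in> \<P>" "i < length (path_edges P)" "k = i \<or> k = Suc i"
      and w: "w = half P i k" and z: "z = half P i (if k = i then Suc i else i)"
      using \<open>R w z\<close> unfolding R_def by (metis n_not_Suc_n)
    obtain P' i' k' where P': "P' \<in> \<P>" "i' < length (path_edges P')" "k' = i' \<or> k' = Suc i'"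
      and w': "w = half P' i' k'" and z': "z' = half P' i' (if k' = i' then Suc i' else i')"
      using \<open>R w z'\<close> unfolding R_def by (metis n_not_Suc_n)
    have "P = P' \<and> i = i' \<and> k = k'"
      by (rule half_inj) (use P P' w w' in auto)
    then show ?thesis
      using z z' by simp
  qed
  \<comment> \<open>The nodes used by paths are closed under \<open>flip\<close>, hence so are the
    remaining ones, on which \<open>flip\<close> can then serve as the matching.\<close>
  have R_flip: "\<exists>z. R (flip w) z" if Rwz: "R w z" for w z
  proof -
    obtain P i where P: "P \<in> \<P>" "i < length (path_edges P)" and w: "w = half P i i \<or> w = half P i (Suc i)"
      using Rwz unfolding R_def by blast
    have D': "\<exists>z. R (half P j j) z" "\<exists>z. R (half P j (Suc j)) z" if "j < length (path_edges P)" for j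
      using P(1) that unfolding R_def by blast+
    have fixed: "flip w = w" if "fst w \<in> X \<union> Y" for w
      using that flip_fixed_iff by blast
    have ends: "path_verts P ! 0 \<in> X \<union> Y" "path_verts P ! length (path_edges P) \<in> X \<union> Y"
      using XYp[OF P(1)] is_path_first_last(1,2)[OF path[OF P(1)]] unfolding XY_path_def by auto
    show ?thesis
      using w
    proof
      assume w: "w = half P i i"
      show ?thesis
      proof (cases i)
        case 0
        then have "flip w = w" using fixed[of w] fst_half[of P i i] ends(1) w by simp
        then show ?thesis using Rwz by metis
      next
        case (Suc j)
        then have "flip w = half P j (Suc j)"
          using flip_half(1)[OF P(1), of j] P(2) w by (metis flip_flip)
        then show ?thesis using D'(2)[of j] P(2) Suc by simp
      qed
    next
      assume w: "w = half P i (Suc i)"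
      show ?thesis
      proof (cases "Suc i = length (path_edges P)")
        case True
        then have "flip w = w" using fixed[of w] fst_half[of P i "Suc i"] ends(2) w by simp
        then show ?thesis using Rwz by metis
      next
        case False
        then have "Suc i < length (path_edges P)" using P(2) by simp
        then show ?thesis using flip_half(1)[OF P(1)] D'(1)[of "Suc i"] w by simp
      qed
    qed
  qed
  have R_joined: "joined w z" and R_neq: "w \<noteq> z" if Rwz: "R w z" for w z
  proof -
    obtain P i where P: "P \<in> \<P>" "i < length (path_edges P)"
      and w: "w = half P i i \<and> z = half P i (Suc i) \<or> w = half P i (Suc i) \<and> z = half P i i"
      using Rwz unfolding R_def by blast
    have nontriv: "\<not> trivial_path P"
      using P(2) unfolding trivial_path_def by auto
    have out: "path_verts P ! k \<notin> X \<inter> Y" if "k \<le> length (path_edges P)" for k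
      using XY_path_avoids_inter[OF XYp[OF P(1)] nontriv vert_in[OF P(1) that]] .
    have e: "path_edges P ! i \<in> edges B"
      "ends B (path_edges P ! i) = {path_verts P ! i, path_verts P ! Suc i}"
      using path[OF P(1)] P(2) unfolding is_path_def by auto
    show "w \<noteq> z"
      using w vert_inj[OF P(1), of i "Suc i"] P(2) fst_half
      by (metis Suc_leI less_imp_le_nat n_not_Suc_n)
    have "path_verts P ! i \<notin> X \<inter> Y" "path_verts P ! Suc i \<notin> X \<inter> Y"
      using out P(2) by simp_all
    then show "joined w z"
      unfolding joined_def
      by (intro bexI[OF _ e(1)]) (use w e(2) in \<open>elim disjE; simp add: half_def insert_commute\<close>)
  qed
  \<comment> \<open>\<open>R_unique\<close> makes the description well defined; \<open>flip\<close>
    is the default at nodes that no path edge uses.\<close>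
  define p where "p w = (if \<exists>z. R w z then THE z. R w z else flip w)" for w
  have p_R: "p w = z" if "R w z" for w z
  proof -
    have "(THE z. R w z) = z"
      using that R_unique[of w] by (intro the_equality)
    then show ?thesis
      unfolding p_def using that by metis
  qed
  have p_flip: "p w = flip w" if "\<nexists>z. R w z" for w
    unfolding p_def using that by simp
  have "linking p"
    unfolding linking_def
  proof (intro conjI allI impI)
    fix w
    show "p (p w) = w"
    proof (cases "\<exists>z. R w z")
      case True
      then show ?thesis using p_R R_sym by metis
    next
      case False
      then have "\<nexists>z. R (flip w) z"
        using R_flip flip_flip by metis
      then show ?thesis using False p_flip by simp
    qed
    show "p w = flip w \<or> joined w (p w)"
      using p_R p_flip R_joined by metis
    show "flip w = w" if "p w = w"
      using that p_R p_flip R_neq by metis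
  qed
  have p_moves: "p (v, Plus) \<noteq> (v, Plus) \<longleftrightarrow> (\<exists>z. R (v, Plus) z)" if "v \<in> X \<union> Y" for v
  proof (cases "\<exists>z. R (v, Plus) z")
    case True
    then obtain z where "R (v, Plus) z" by blast
    then show ?thesis
      using p_R[of "(v, Plus)" z] R_neq[of "(v, Plus)" z] by metis
  next
    case False
    moreover have "flip (v, Plus) = (v, Plus)"
      using flip_fixed_iff[of "(v, Plus)"] that by simp
    ultimately show ?thesis
      using p_flip[of "(v, Plus)"] by simp
  qed
  have R_vertex: "\<exists>P \<in> \<P>. \<not> trivial_path P \<and> v \<in> set (path_verts P)" if Rwz: "R (v, t) z" for v t z
  proof -
    obtain P i where P: "P \<in> \<P>" "i < length (path_edges P)"
      and w: "(v, t) = half P i i \<or> (v, t) = half P i (Suc i)"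
      using Rwz unfolding R_def by blast
    then have "v = path_verts P ! i \<or> v = path_verts P ! Suc i"
      using fst_half[of P i i] fst_half[of P i "Suc i"] by (metis fst_conv)
    then have "v \<in> set (path_verts P)"
      using vert_in[OF P(1), of i] vert_in[OF P(1), of "Suc i"] P(2) by auto
    moreover have "\<not> trivial_path P"
      using P(2) unfolding trivial_path_def by linarith
    ultimately show ?thesis
      using P(1) by blast
  qed
  have R_ends: "\<exists>z. R (first_vertex P, Plus) z" "\<exists>z. R (last_vertex P, Plus) z"
    if P: "P \<in> \<P>" "\<not> trivial_path P" for P
  proof -
    let ?l = "length (path_edges P)"
    have l: "0 < ?l" using P(2) unfolding trivial_path_def by simp
    have "first_vertex P \<in> X" "last_vertex P \<in> Y"
      using XYp[OF P(1)] unfolding XY_path_def by auto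
    then have "half P 0 0 = (first_vertex P, Plus)" "half P (?l - 1) ?l = (last_vertex P, Plus)"
      using is_path_first_last(1,2)[OF path[OF P(1)]] unfolding half_def node_def by auto
    moreover have "R (half P 0 0) (half P 0 (Suc 0))"
      unfolding R_def using P(1) l by blast
    moreover have "R (half P (?l - 1) (Suc (?l - 1))) (half P (?l - 1) (?l - 1))"
      unfolding R_def using P(1) diff_less[OF zero_less_one l] by blast
    ultimately show "\<exists>z. R (first_vertex P, Plus) z" "\<exists>z. R (last_vertex P, Plus) z"
      using l by (simp_all del: split_paired_Ex) blast+
  qed
  let ?N = "{P \<in> \<P>. \<not> trivial_path P}"
  have XY_ends: "first_vertex P \<in> X" "last_vertex P \<in> Y" if "P \<in> \<P>" for P
    using XYp[OF that] unfolding XY_path_def by auto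
  have covX: "covered p (X - Y) = first_vertex ` \<P> - Y"
  proof (intro subset_antisym subsetI)
    fix v assume v: "v \<in> covered p (X - Y)"
    then have "\<exists>z. R (v, Plus) z" using p_moves unfolding covered_def by auto
    then obtain P where "P \<in> ?N" "v \<in> set (path_verts P)" using R_vertex by blast
    then show "v \<in> first_vertex ` \<P> - Y"
      using v XY_path_X_iff(1)[OF XYp] unfolding covered_def by blast
  next
    fix v assume v: "v \<in> first_vertex ` \<P> - Y"
    then obtain P where "P \<in> ?N" "v = first_vertex P"
      using nontrivial_ends(1)[OF D] by blast
    then show "v \<in> covered p (X - Y)"
      using v p_moves[of v] R_ends(1)[of P] XY_ends(1)[of P] unfolding covered_def by auto
  qed
  have covY: "covered p (Y - X) = last_vertex ` \<P> - X"
  proof (intro subset_antisym subsetI)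
    fix v assume v: "v \<in> covered p (Y - X)"
    then have "\<exists>z. R (v, Plus) z" using p_moves unfolding covered_def by auto
    then obtain P where "P \<in> ?N" "v \<in> set (path_verts P)" using R_vertex by blast
    then show "v \<in> last_vertex ` \<P> - X"
      using v XY_path_X_iff(2)[OF XYp] unfolding covered_def by blast
  next
    fix v assume v: "v \<in> last_vertex ` \<P> - X"
    then obtain P where "P \<in> ?N" "v = last_vertex P"
      using nontrivial_ends(2)[OF D] by blast
    then show "v \<in> covered p (Y - X)"
      using v p_moves[of v] R_ends(2)[of P] XY_ends(2)[of P] unfolding covered_def by auto
  qed
  have "inj_on first_vertex ?N" "inj_on last_vertex ?N"
    by (rule inj_on_subset[OF disjoint_paths_inj(1)[OF D]] inj_on_subset[OF disjoint_paths_inj(2)[OF D]]; blast)+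
  then have "balanced p"
    unfolding balanced_def covX covY nontrivial_ends[OF D, symmetric] by (simp add: card_image)
  from that[OF \<open>linking p\<close> this covX covY] show thesis .
qed

end

section \<open>The exchange theorem for disjoint \<open>X\<close>--\<open>Y\<close> paths\<close>

theorem corollary7p12:
  fixes B :: "('v, 'e) bidigraph"
    and X Y :: "'v set"
    and \<P> \<Q> :: "('v, 'e) walk set"
  assumes "finite_bidirected_graph B"
    and "X \<subseteq> verts B" and "Y \<subseteq> verts B"
    and "\<not> (\<exists>P. is_path B P \<and> \<not> trivial_path P \<and> first_vertex P \<in> X \<and> last_vertex P \<in> X)"
    and "disjoint_XY_paths B X Y \<P>"
    and "disjoint_XY_paths B X Y \<Q>"
  shows "\<exists>\<R>. disjoint_XY_paths B X Y \<R> \<and>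
    first_vertex ` \<P> \<subseteq> first_vertex ` \<R> \<and>
    last_vertex ` \<Q> \<subseteq> last_vertex ` \<R>"
proof -
  interpret clean_pair B X Y
    using assms by unfold_locales
  obtain p where p: "linking p" "balanced p" "covered p (X - Y) = first_vertex ` \<P> - Y"
    "covered p (Y - X) = last_vertex ` \<P> - X"
    by (rule disjoint_paths_linking[OF assms(5)])
  obtain q where q: "linking q" "balanced q" "covered q (X - Y) = first_vertex ` \<Q> - Y"
    "covered q (Y - X) = last_vertex ` \<Q> - X"
    by (rule disjoint_paths_linking[OF assms(6)])
  obtain n where n: "linking n" "balanced n"
    "first_vertex ` \<P> - Y \<subseteq> covered n (X - Y)" "last_vertex ` \<Q> - X \<subseteq> covered n (Y - X)"
    by (rule exchange[OF p(1,2) q(1,2), unfolded p(3) q(4)])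
  obtain \<R> where R: "disjoint_XY_paths B X Y \<R>"
    "first_vertex ` \<R> = covered n (X - Y) \<union> (X \<inter> Y)"
    "last_vertex ` \<R> = covered n (Y - X) \<union> (X \<inter> Y)"
    by (rule balanced_disjoint_paths[OF n(1,2)])
  \<comment> \<open>First vertices in \<open>Y\<close> and last vertices in \<open>X\<close> thus
    lie in \<open>X \<inter> Y\<close>, which both end sets of \<open>\<R>\<close> contain; the
    other ends are handled by \<open>n\<close>.\<close>
  have "first_vertex ` \<P> \<subseteq> X" "last_vertex ` \<Q> \<subseteq> Y"
    using assms(5,6) unfolding disjoint_XY_paths_def XY_path_def by auto
  then have "first_vertex ` \<P> \<subseteq> first_vertex ` \<R>" "last_vertex ` \<Q> \<subseteq> last_vertex ` \<R>"
    unfolding R(2,3) using n(3,4) by auto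
  then show ?thesis
    using R(1) by blast
qed

end
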